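(* Let $n\ge 1$, let $Y\in O_n(\mathbb{Q})$ be a rational orthogonal matrix, and write $Y=\frac{1}{q}Z$, where $q$ is a positive integer and $Z$ is an $n\times n$ integer matrix with $\gcd(Z)=1$. For $i=1,\ldots,n$ let $\delta_i$ be the greatest common divisor of the determinants of all $i\times i$ submatrices of $Z$ (and set $\delta_0=1$). Then $$\Sigma(Y)=\frac{q^{m}}{\delta_{m}},$$ where $m=[n/2]$ is the integer part of $n/2$.
   Context: $O_n(\mathbb{Q})$ denotes the group of $n\times n$ orthogonal matrices with rational entries. For a nonzero integer matrix $Z$, $\gcd(Z)$ denotes the greatest common divisor of its nonzero entries. Every $Y\in O_n(\mathbb{Q})$ can be written uniquely as $Y=\frac1q Z$ with $q$ a positive integer and $Z$ an integer matrix with $\gcd(Z)=1$. For $Y\in O_n(\mathbb{Q})$, acting on $\mathbb{R}^n$ with respect to the canonical basis, the coincidence index is the (finite) group index $\Sigma(Y)=[\mathbb{Z}^n:\mathbb{Z}^n\cap Y\mathbb{Z}^n]$. *)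

theory Defs
  imports
    "HOL-Algebra.Coset"
    "Jordan_Normal_Form.Determinant"
    "Jordan_Normal_Form.DL_Submatrix"
begin

(* The predicate orthogonal_mat of Jordan_Normal_Form only requires the columns to be
   pairwise orthogonal and nonzero, so it is not used here.  Rational matrices are
   represented inside the real matrices, since they act on R^n. *)
definition rational_orthogonal_group :: "nat \<Rightarrow> real mat set" where
  "rational_orthogonal_group n =
     {Y \<in> carrier_mat n n. elements_mat Y \<subseteq> \<rat> \<and>
        transpose_mat Y * Y = 1\<^sub>m n \<and> Y * transpose_mat Y = 1\<^sub>m n}"

definition integer_lattice :: "nat \<Rightarrow> real vec set" where
  "integer_lattice n = {v \<in> carrier_vec n. \<forall>i<n. v $ i \<in> \<int>}"

definition integer_lattice_group :: "nat \<Rightarrow> real vec monoid" where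
  "integer_lattice_group n = (monoid_vec TYPE(real) n)\<lparr>carrier := integer_lattice n\<rparr>"

(* The lattice Z^n \<inter> Y Z^n. *)
definition coincidence_lattice :: "nat \<Rightarrow> real mat \<Rightarrow> real vec set" where
  "coincidence_lattice n Y = integer_lattice n \<inter> (\<lambda>v. Y *\<^sub>v v) ` integer_lattice n"

(* The group index [Z^n : Z^n \<inter> Y Z^n].  As usual for card, it would be 0 for an
   infinite index; for rational orthogonal Y the index is finite. *)
definition coincidence_index :: "nat \<Rightarrow> real mat \<Rightarrow> nat" where
  "coincidence_index n Y = card (rcosets\<^bsub>integer_lattice_group n\<^esub> (coincidence_lattice n Y))"

definition mat_gcd :: "int mat \<Rightarrow> int" where
  "mat_gcd Z = Gcd (elements_mat Z - {0})"

(* Row and column indices start at 0.  For i = 0 the only minor is the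
   determinant of the empty matrix, which is 1. *)
definition det_divisor :: "int mat \<Rightarrow> nat \<Rightarrow> int" where
  "det_divisor Z i =
     Gcd {det (submatrix Z I J) | I J.
            I \<subseteq> {..<dim_row Z} \<and> J \<subseteq> {..<dim_col Z} \<and> card I = i \<and> card J = i}"

lemma det_divisor_0: "det_divisor Z 0 = 1"
proof -
  have "det (submatrix Z {} {}) = 1"
    by (intro det_dim_zero) (simp add: submatrix_def)
  moreover have "{det (submatrix Z I J) | I J.
      I \<subseteq> {..<dim_row Z} \<and> J \<subseteq> {..<dim_col Z} \<and> card I = 0 \<and> card J = 0}
    = {det (submatrix Z {} {})}"
  proof -
    have "finite I" if "I \<subseteq> {..<k}" for I and k :: nat
      using that finite_subset by blast
    then show ?thesis by (auto simp: card_eq_0_iff) 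
  qed
  ultimately show ?thesis unfolding det_divisor_def by simp
qed

lemma coincidence_lattice_subgroup:
  assumes Y: "Y \<in> carrier_mat n n"
  shows "subgroup (coincidence_lattice n Y) (monoid_vec TYPE(real) n)"
proof -
  interpret V: comm_group "monoid_vec TYPE(real) n" by (rule comm_group_vec)
  have inv: "inv\<^bsub>monoid_vec TYPE(real) n\<^esub> v = - v" if "v \<in> carrier_vec n" for v
    by (rule V.inv_equality) (use that in \<open>auto simp: monoid_vec_simps\<close>)
  have L: "subgroup (integer_lattice n) (monoid_vec TYPE(real) n)"
    by (rule V.subgroupI)
       (auto simp: integer_lattice_def monoid_vec_simps inv intro!: exI[of _ "0\<^sub>v n"])
  have "(\<lambda>v. Y *\<^sub>v v) \<in> hom (monoid_vec TYPE(real) n) (monoid_vec TYPE(real) n)"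
    using Y by (auto simp: hom_def monoid_vec_simps mult_add_distrib_mat_vec)
  then interpret H: group_hom "monoid_vec TYPE(real) n" "monoid_vec TYPE(real) n" "\<lambda>v. Y *\<^sub>v v"
    by unfold_locales
  show ?thesis unfolding coincidence_lattice_def
    by (intro V.subgroups_Inter_pair L H.subgroup_img_is_subgroup)
qed

end

theory Submission
  imports Defs
begin

text \<open>
  Why the formula holds.  Bring the transpose of \<open>Z\<close> into Smith normal form: after multiplying by
  unimodular matrices on both sides it becomes a diagonal matrix \<open>D\<close> with entries
  \<open>d 0\<close>, \<dots>, \<open>d (n - 1)\<close>, each dividing the next (\<open>smith_normal_form_exists\<close>).  Both sides of the
  claim can be read off from these entries.

  The determinantal divisors do not change under transposition and under unimodular multiplication
  (\<open>det_divisor_mat_equiv\<close>), because a minor of a product is an integer combination of minors of each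
  factor.  For \<open>D\<close> the \<open>k\<close>-th one is the absolute value of the product of the first \<open>k\<close> entries.

  Since the inverse of \<open>Y\<close> is its transpose, an integer vector \<open>v\<close> lies in the coincidence lattice iff
  \<open>q\<close> divides every entry of \<open>Z\<^sup>T v\<close>.  In the coordinates of the normal form the condition
  decouples into \<open>q dvd d i * x i\<close>, that is, \<open>x i\<close> is a multiple of \<open>q div gcd q (d i)\<close>.  Hence the
  index is the product of these \<open>n\<close> numbers (\<open>coincidence_index_eq_prod\<close>).

  Orthogonality relates the two ends of the diagonal.  From \<open>Z\<^sup>T Z = q\<^sup>2\<close> it follows that
  \<open>q\<^sup>2 D\<inverse>\<close> is an integer matrix equivalent to \<open>Z\<close>.  It has the same determinantal divisors
  as \<open>D\<close>, but its divisor chain runs backwards, so up to sign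
  \<open>d i * d (n - 1 - i) = q\<^sup>2\<close> (\<open>abs_mult_reversed_diagonal\<close>).  With the divisor chain this
  gives \<open>d i dvd q\<close> in the first half of the diagonal and \<open>q dvd d i\<close> in the rest.  So the index has
  the factor \<open>q / \<bar>d i\<bar>\<close> for \<open>i < n div 2\<close> and the factor \<open>1\<close> for the other \<open>i\<close>, and the
  product of the \<open>\<bar>d i\<bar>\<close> with \<open>i < n div 2\<close> is the determinantal divisor of order \<open>n div 2\<close>.
\<close>

section \<open>Determinantal divisors\<close>

text \<open>
  Unlike \<^const>\<open>submatrix\<close>, the index maps may repeat and permute rows and columns.  Such
  generalised minors are what the multilinear expansion of the determinant of a product produces.
\<close>

definition selected_entries :: "nat \<Rightarrow> (nat \<Rightarrow> nat) \<Rightarrow> (nat \<Rightarrow> nat) \<Rightarrow> 'a mat \<Rightarrow> 'a mat" where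
  "selected_entries k f g A = mat k k (\<lambda>(i, j). A $$ (f i, g j))"

lemma selected_entries_carrier [simp]: "selected_entries k f g A \<in> carrier_mat k k"
  by (simp add: selected_entries_def)

lemma submatrix_eq_selected_entries:
  assumes "I \<subseteq> {..<dim_row A}" "J \<subseteq> {..<dim_col A}" "card I = k" "card J = k"
  shows "submatrix A I J = selected_entries k (pick I) (pick J) A"
proof -
  have "{i. i < dim_row A \<and> i \<in> I} = I" "{i. i < dim_col A \<and> i \<in> J} = J" using assms by auto
  then show ?thesis using assms by (simp add: submatrix_def selected_entries_def)
qed

lemma det_divisor_dvd_iff:
  "x dvd det_divisor A k \<longleftrightarrow> (\<forall>I J. I \<subseteq> {..<dim_row A} \<longrightarrow> J \<subseteq> {..<dim_col A} \<longrightarrow>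
     card I = k \<longrightarrow> card J = k \<longrightarrow> x dvd det (selected_entries k (pick I) (pick J) A))"
proof -
  have "x dvd det_divisor A k \<longleftrightarrow> (\<forall>I J. I \<subseteq> {..<dim_row A} \<and> J \<subseteq> {..<dim_col A} \<and>
     card I = k \<and> card J = k \<longrightarrow> x dvd det (submatrix A I J))"
    unfolding det_divisor_def dvd_Gcd_iff by blast
  then show ?thesis by (simp add: submatrix_eq_selected_entries imp_conjL)
qed

lemma det_divisor_dvd_submatrix:
  assumes "I \<subseteq> {..<dim_row A}" "J \<subseteq> {..<dim_col A}" "card I = k" "card J = k"
  shows "det_divisor A k dvd det (selected_entries k (pick I) (pick J) A)"
  using det_divisor_dvd_iff[THEN iffD1, OF dvd_refl] assms by blast

lemma normalize_det_divisor: "normalize (det_divisor A k) = det_divisor A k"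
  by (simp add: det_divisor_def)

lemma selected_entries_transpose:
  assumes "\<And>i. i < k \<Longrightarrow> f i < dim_row A" "\<And>i. i < k \<Longrightarrow> g i < dim_col A"
  shows "selected_entries k g f (transpose_mat A) = transpose_mat (selected_entries k f g A)"
  by (rule eq_matI) (use assms in \<open>auto simp: selected_entries_def\<close>)

lemma pick_less:
  assumes "I \<subseteq> {..<r}" "card I = k" "i < k"
  shows "pick I i < r"
  using pick_in_set_le[of i I] assms by auto

lemma det_selected_entries_transpose:
  assumes "\<And>i. i < k \<Longrightarrow> f i < dim_row A" "\<And>i. i < k \<Longrightarrow> g i < dim_col A"
  shows "det (selected_entries k g f (transpose_mat A)) = det (selected_entries k f g A)"
  using assms by (simp add: selected_entries_transpose det_transpose[of _ k])

lemma det_divisor_dvd_det_divisor_transpose: "det_divisor A k dvd det_divisor (transpose_mat A) k"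
  unfolding det_divisor_dvd_iff
proof (intro allI impI)
  fix J I assume IJ: "J \<subseteq> {..<dim_row (transpose_mat A)}" "I \<subseteq> {..<dim_col (transpose_mat A)}"
    "card J = k" "card I = k"
  then have "det (selected_entries k (pick J) (pick I) (transpose_mat A)) = det (selected_entries k (pick I) (pick J) A)"
    by (intro det_selected_entries_transpose) (auto intro: pick_less)
  then show "det_divisor A k dvd det (selected_entries k (pick J) (pick I) (transpose_mat A))"
    using IJ by (simp add: det_divisor_dvd_submatrix)
qed

lemma det_divisor_transpose: "det_divisor (transpose_mat A) k = det_divisor A k"
proof (rule associated_eqI)
  show "det_divisor A k dvd det_divisor (transpose_mat A) k"
    by (rule det_divisor_dvd_det_divisor_transpose)
  show "det_divisor (transpose_mat A) k dvd det_divisor A k"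
    using det_divisor_dvd_det_divisor_transpose[of "transpose_mat A" k] by simp
qed (rule normalize_det_divisor)+

text \<open>
  An injective selection of rows lists its range in some order; \<^const>\<open>pick\<close> lists it in increasing
  order, and \<open>p\<close> is the permutation between the two.
\<close>

lemma arrange_as_pick:
  assumes "inj_on f {..<k}"
  obtains p where "p permutes {0..<k}" "card (f ` {..<k}) = k" "\<And>i. i < k \<Longrightarrow> pick (f ` {..<k}) (p i) = f i"
proof -
  define I where "I = f ` {..<k}"
  have card: "card I = k" using assms by (simp add: I_def card_image)
  have fin: "finite I" by (simp add: I_def)
  define p where "p i = (if i < k then card {a \<in> I. a < f i} else i)" for i
  have pick: "pick I (p i) = f i" if "i < k" for i
    using that pick_card_in_set[of "f i" I] by (auto simp: p_def I_def)
  have less: "p i < k" if "i < k" for i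
  proof -
    have "f i \<in> I" using that by (auto simp: I_def)
    then have "card {a \<in> I. a < f i} < card I" by (intro psubset_card_mono fin) auto
    then show ?thesis using that card by (simp add: p_def)
  qed
  have "inj_on p {0..<k}"
  proof (rule inj_onI)
    fix i j assume "i \<in> {0..<k}" "j \<in> {0..<k}" "p i = p j"
    then have "f i = f j" "i \<in> {..<k}" "j \<in> {..<k}" using pick[of i] pick[of j] by auto
    then show "i = j" using assms by (auto dest: inj_onD)
  qed
  moreover from this have "p ` {0..<k} = {0..<k}" using less by (intro endo_inj_surj) auto
  ultimately have "bij_betw p {0..<k} {0..<k}" by (simp add: bij_betw_def)
  then have "p permutes {0..<k}" by (rule bij_imp_permutes) (simp add: p_def)
  then show ?thesis by (rule that) (use pick card in \<open>auto simp: I_def\<close>)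
qed

text \<open>
  Generalised minors add nothing to the gcd: a repeated row makes the determinant vanish, and
  otherwise sorting the rows changes only its sign.
\<close>

lemma dvd_det_selected_rows:
  fixes A :: "int mat"
  assumes f: "\<And>i. i < k \<Longrightarrow> f i < r"
    and dvd: "\<And>I. I \<subseteq> {..<r} \<Longrightarrow> card I = k \<Longrightarrow> x dvd det (selected_entries k (pick I) g A)"
  shows "x dvd det (selected_entries k f g A)"
proof (cases "inj_on f {..<k}")
  case True
  then obtain p where p: "p permutes {0..<k}" "card (f ` {..<k}) = k"
    "\<And>i. i < k \<Longrightarrow> pick (f ` {..<k}) (p i) = f i" by (rule arrange_as_pick) blast
  define B where "B = selected_entries k (pick (f ` {..<k})) g A"
  have "p i < k" if "i < k" for i using permutes_in_image[OF p(1), of i] that by auto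
  then have "selected_entries k f g A = mat k k (\<lambda>(i, j). B $$ (p i, j))"
    by (intro eq_matI) (auto simp: B_def selected_entries_def p(3))
  moreover have "B \<in> carrier_mat k k" by (simp add: B_def)
  ultimately have "det (selected_entries k f g A) = signof p * det B"
    using det_permute_rows[OF _ p(1), of B] by simp
  moreover have "x dvd det B" unfolding B_def using f p(2) by (intro dvd) auto
  ultimately show ?thesis by simp
next
  case False
  then obtain i j where ij: "i < k" "j < k" "i \<noteq> j" "f i = f j" by (auto simp: inj_on_def)
  have "det (selected_entries k f g A) = 0"
    by (rule det_identical_rows[of _ k i j]) (use ij in \<open>auto simp: selected_entries_def intro!: eq_vecI\<close>)
  then show ?thesis by simp
qed

lemma det_divisor_dvd_det_selected_entries:
  assumes f: "\<And>i. i < k \<Longrightarrow> f i < dim_row A" and g: "\<And>i. i < k \<Longrightarrow> g i < dim_col A"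
  shows "det_divisor A k dvd det (selected_entries k f g A)"
proof (rule dvd_det_selected_rows[OF f])
  fix I assume I: "I \<subseteq> {..<dim_row A}" "card I = k"
  have "det_divisor A k dvd det (selected_entries k g (pick I) (transpose_mat A))"
  proof (rule dvd_det_selected_rows[OF g])
    fix J assume J: "J \<subseteq> {..<dim_col A}" "card J = k"
    have "det (selected_entries k (pick J) (pick I) (transpose_mat A)) = det (selected_entries k (pick I) (pick J) A)"
      using I J by (intro det_selected_entries_transpose) (auto intro: pick_less)
    then show "det_divisor A k dvd det (selected_entries k (pick J) (pick I) (transpose_mat A))"
      using I J by (simp add: det_divisor_dvd_submatrix)
  qed
  also have "det (selected_entries k g (pick I) (transpose_mat A)) = det (selected_entries k (pick I) g A)"
    using I g by (intro det_selected_entries_transpose) (auto intro: pick_less)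
  finally show "det_divisor A k dvd det (selected_entries k (pick I) g A)" .
qed

text \<open>
  Each row of \<open>P * B\<close> is an integer combination of the rows of \<open>B\<close>, so by multilinearity the
  determinant is an integer combination of determinants of row selections of \<open>B\<close>.  This is the part
  of the Cauchy-Binet formula that divisibility questions need.
\<close>

lemma dvd_det_left_mult:
  fixes B :: "int mat"
  assumes P: "P \<in> carrier_mat k r" and B: "B \<in> carrier_mat r k"
    and dvd: "\<And>f. (\<And>i. i < k \<Longrightarrow> f i < r) \<Longrightarrow> x dvd det (selected_entries k f id B)"
  shows "x dvd det (P * B)"
proof -
  have "x dvd det (mat\<^sub>r k k (\<lambda>i. P $$ (i, f i) \<cdot>\<^sub>v row B (f i)))"
    if f: "\<And>i. i < k \<Longrightarrow> f i < r" for f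
  proof -
    have "det (mat\<^sub>r k k (\<lambda>i. P $$ (i, f i) \<cdot>\<^sub>v row B (f i))) =
        prod (\<lambda>i. P $$ (i, f i)) {0..<k} * det (mat\<^sub>r k k (\<lambda>i. row B (f i)))"
      by (rule det_rows_mul) (use B f in auto)
    also have "mat\<^sub>r k k (\<lambda>i. row B (f i)) = selected_entries k f id B"
      by (rule eq_matI) (use B f in \<open>auto simp: selected_entries_def\<close>)
    finally show ?thesis using dvd[OF f] by simp
  qed
  moreover have "det (P * B) = (\<Sum>f \<in> {f. (\<forall>i\<in>{0..<k}. f i \<in> {0..<r}) \<and> (\<forall>i. i \<notin> {0..<k} \<longrightarrow> f i = i)}.
      det (mat\<^sub>r k k (\<lambda>i. P $$ (i, f i) \<cdot>\<^sub>v row B (f i))))"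
    unfolding mat_mul_finsum_alt[OF P B] by (rule det_linear_rows_sum) (use B in auto)
  ultimately show ?thesis by (auto intro!: dvd_sum)
qed

lemma det_divisor_dvd_det_mult:
  assumes P: "P \<in> carrier_mat k r" and A: "A \<in> carrier_mat r c" and Q: "Q \<in> carrier_mat c k"
  shows "det_divisor A k dvd det (P * A * Q)"
proof -
  have "det_divisor A k dvd det (P * (A * Q))"
  proof (rule dvd_det_left_mult[of _ _ r])
    fix f assume f: "\<And>i. i < k \<Longrightarrow> f i < r"
    \<comment> \<open>The columns are expanded in the same way, after transposing.\<close>
    define B where "B = mat k c (\<lambda>(i, j). A $$ (f i, j))"
    have "selected_entries k f id (A * Q) = B * Q"
      by (rule eq_matI) (use A Q f in \<open>auto simp: selected_entries_def B_def scalar_prod_def\<close>)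
    moreover have "det (B * Q) = det (transpose_mat Q * transpose_mat B)"
    proof -
      have B: "B \<in> carrier_mat k c" by (simp add: B_def)
      then have "det (transpose_mat (B * Q)) = det (B * Q)" using Q by (intro det_transpose) auto
      then show ?thesis using transpose_mult[OF B Q] by simp
    qed
    moreover have "det_divisor A k dvd det (transpose_mat Q * transpose_mat B)"
    proof (rule dvd_det_left_mult[of _ _ c])
      fix g assume g: "\<And>i. i < k \<Longrightarrow> g i < c"
      have "selected_entries k g id (transpose_mat B) = transpose_mat (selected_entries k f g A)"
        by (rule eq_matI) (use A f g in \<open>auto simp: selected_entries_def B_def\<close>)
      then show "det_divisor A k dvd det (selected_entries k g id (transpose_mat B))"
        using det_divisor_dvd_det_selected_entries[of k f A g] A f g by (simp add: det_transpose[of _ k])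
    qed (use Q in \<open>auto simp: B_def\<close>)
    ultimately show "det_divisor A k dvd det (selected_entries k f id (A * Q))" by simp
  qed (use P A Q in auto)
  then show ?thesis using assms by (simp add: assoc_mult_mat[of _ k r _ c _ k])
qed

text \<open>
  A minor of \<open>P * A * Q\<close> is the determinant of \<open>P' * A * Q'\<close>, where \<open>P'\<close> consists of rows of
  \<open>P\<close> and \<open>Q'\<close> of columns of \<open>Q\<close>.
\<close>

lemma det_divisor_dvd_det_divisor_mult:
  assumes P: "P \<in> carrier_mat r' r" and A: "A \<in> carrier_mat r c" and Q: "Q \<in> carrier_mat c c'"
  shows "det_divisor A k dvd det_divisor (P * A * Q) k"
  unfolding det_divisor_dvd_iff
proof (intro allI impI)
  fix I J assume I: "I \<subseteq> {..<dim_row (P * A * Q)}" "card I = k" and J: "J \<subseteq> {..<dim_col (P * A * Q)}" "card J = k"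
  have i: "pick I i < r'" "pick J i < c'" if "i < k" for i
    using that I J P Q by (auto intro: pick_less)
  define P' where "P' = mat k r (\<lambda>(i, j). P $$ (pick I i, j))"
  define Q' where "Q' = mat c k (\<lambda>(i, j). Q $$ (i, pick J j))"
  have P': "P' \<in> carrier_mat k r" and Q': "Q' \<in> carrier_mat c k" by (auto simp: P'_def Q'_def)
  have rows: "row P' l = row P (pick I l)" "col Q' l = col Q (pick J l)" if "l < k" for l
    using that i P Q by (auto simp: P'_def Q'_def)
  have "selected_entries k (pick I) (pick J) (P * (A * Q)) = P' * (A * Q')"
    by (rule eq_matI) (use i P Q A P' Q' in \<open>auto simp: rows selected_entries_def\<close>)
  then have "selected_entries k (pick I) (pick J) (P * A * Q) = P' * A * Q'"
    using assoc_mult_mat[OF P A Q] assoc_mult_mat[OF P' A Q'] by simp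
  moreover have "det_divisor A k dvd det (P' * A * Q')"
    by (rule det_divisor_dvd_det_mult[OF _ A]) (auto simp: P'_def Q'_def)
  ultimately show "det_divisor A k dvd det (selected_entries k (pick I) (pick J) (P * A * Q))" by simp
qed

text \<open>
  In the Leibniz expansion of a minor of a diagonal matrix a term can be nonzero only if it picks
  diagonal entries, so every term is a multiple of the product of the entries in the chosen rows.
  Stating the result for an arbitrary optimal index set \<open>K\<close> covers divisor chains in both directions.
\<close>

lemma det_divisor_mat_diag:
  fixes d :: "nat \<Rightarrow> int"
  assumes K: "K \<subseteq> {..<n}" "card K = k"
    and least: "\<And>I. I \<subseteq> {..<n} \<Longrightarrow> card I = k \<Longrightarrow> (\<Prod>i\<in>K. d i) dvd (\<Prod>i\<in>I. d i)"
  shows "det_divisor (mat_diag n d) k = \<bar>\<Prod>i\<in>K. d i\<bar>"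
proof -
  have pick_prod: "(\<Prod>i = 0..<k. d (pick I i)) = (\<Prod>i\<in>I. d i)" if I: "I \<subseteq> {..<n}" "card I = k" for I
  proof -
    have "pick I i \<noteq> pick I j" if "i < j" "j < k" for i j
      using pick_mono_le[of j I i] that I by auto
    then have "inj_on (pick I) {0..<k}" by (intro linorder_inj_onI') auto
    moreover have "pick I ` {0..<k} \<subseteq> I" using pick_in_set_le[of _ I] I by auto
    moreover have "finite I" using I finite_subset by blast
    moreover from calculation have "pick I ` {0..<k} = I"
      using I by (intro card_subset_eq) (auto simp: card_image)
    ultimately have "bij_betw (pick I) {0..<k} I" by (simp add: bij_betw_def)
    then show ?thesis by (rule prod.reindex_bij_betw)
  qed
  show ?thesis
  proof (rule associated_eqI)
    have "det (selected_entries k (pick K) (pick K) (mat_diag n d))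
        = prod_list (diag_mat (selected_entries k (pick K) (pick K) (mat_diag n d)))"
    proof (rule det_upper_triangular)
      have "pick K i \<noteq> pick K j" if "j < i" "i < k" for i j using pick_mono_le[of i K j] that K by auto
      then show "upper_triangular (selected_entries k (pick K) (pick K) (mat_diag n d))"
        using K by (auto simp: upper_triangular_def selected_entries_def mat_diag_def pick_less)
    qed (rule selected_entries_carrier)
    also have "\<dots> = (\<Prod>i\<in>K. d i)"
      using K pick_less[OF K] by (simp add: prod_list_diag_prod selected_entries_def mat_diag_def pick_prod[OF K, symmetric])
    finally show "det_divisor (mat_diag n d) k dvd \<bar>\<Prod>i\<in>K. d i\<bar>"
      using det_divisor_dvd_submatrix[of K "mat_diag n d" K k] K by (simp add: mat_diag_def)
    show "\<bar>\<Prod>i\<in>K. d i\<bar> dvd det_divisor (mat_diag n d) k"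
      unfolding det_divisor_dvd_iff
    proof (intro allI impI)
      fix I J assume "I \<subseteq> {..<dim_row (mat_diag n d)}" "J \<subseteq> {..<dim_col (mat_diag n d)}" and k: "card I = k" "card J = k"
      then have I: "I \<subseteq> {..<n}" and J: "J \<subseteq> {..<n}" by (auto simp: mat_diag_def)
      let ?M = "selected_entries k (pick I) (pick J) (mat_diag n d)"
      have "(\<Prod>i\<in>K. d i) dvd (\<Prod>i = 0..<k. ?M $$ (i, p i))" if p: "p permutes {0..<k}" for p
      proof -
        have pk: "p i < k" if "i < k" for i using permutes_in_image[OF p, of i] that by auto
        have "(\<Prod>i = 0..<k. d (pick I i)) dvd (\<Prod>i = 0..<k. ?M $$ (i, p i))"
          by (rule prod_dvd_prod) (use pk I J k in \<open>auto simp: selected_entries_def mat_diag_def pick_less\<close>)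
        then show ?thesis using least[OF I] k pick_prod[OF I] by (auto intro: dvd_trans)
      qed
      then show "\<bar>\<Prod>i\<in>K. d i\<bar> dvd det ?M"
        by (auto simp: det_def'[of _ k] intro!: dvd_sum)
    qed
  qed (rule normalize_det_divisor, simp)
qed

text \<open>
  The \<open>k\<close>-th smallest element of \<open>I\<close> is at least \<open>k\<close> (counting from 0), so the factors can be
  compared one by one.
\<close>

lemma prod_initial_dvd:
  fixes d :: "nat \<Rightarrow> 'a :: comm_semiring_1"
  assumes d: "\<And>i j. i \<le> j \<Longrightarrow> j < n \<Longrightarrow> d i dvd d j" and I: "I \<subseteq> {..<n}"
  shows "(\<Prod>i<card I. d i) dvd (\<Prod>i\<in>I. d i)"
proof -
  have "(\<Prod>i<k. d i) dvd (\<Prod>i\<in>I. d i)" if "I \<subseteq> {..<n}" "card I = k" for k I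
    using that
  proof (induction k arbitrary: I)
    case (Suc k)
    have fin: "finite I" using Suc.prems finite_subset by blast
    have ne: "I \<noteq> {}" using Suc.prems by auto
    define m where "m = Max I"
    have m: "m \<in> I" using fin ne by (simp add: m_def)
    have "I \<subseteq> {..m}" using fin by (auto simp: m_def)
    then have "card I \<le> Suc m" using card_mono[of "{..m}" I] by simp
    then have "d k dvd d m" using Suc.prems m by (intro d) auto
    moreover have "(\<Prod>i<k. d i) dvd (\<Prod>i\<in>I - {m}. d i)" using Suc.prems m fin by (intro Suc.IH) auto
    ultimately show ?case using m fin
      by (simp add: prod.remove[OF fin m] mult_dvd_mono mult.commute)
  qed simp
  then show ?thesis using I by blast
qed

lemma det_divisor_divisor_chain:
  fixes d :: "nat \<Rightarrow> int"
  assumes "\<And>i j. i \<le> j \<Longrightarrow> j < n \<Longrightarrow> d i dvd d j" and "k \<le> n"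
  shows "det_divisor (mat_diag n d) k = \<bar>\<Prod>i<k. d i\<bar>"
  using assms by (intro det_divisor_mat_diag) (auto dest: prod_initial_dvd[of n d, rotated])

lemma det_divisor_reversed_divisor_chain:
  fixes d :: "nat \<Rightarrow> int"
  assumes d: "\<And>i j. i \<le> j \<Longrightarrow> j < n \<Longrightarrow> d j dvd d i" and k: "k \<le> n"
  shows "det_divisor (mat_diag n d) k = \<bar>\<Prod>i<k. d (n - 1 - i)\<bar>"
proof -
  let ?r = "\<lambda>i. n - 1 - i"
  have inj: "inj_on ?r {..<n}" by (auto simp: inj_on_def)
  have reindex: "(\<Prod>i\<in>?r ` I. f i) = (\<Prod>i\<in>I. f (?r i))" if "I \<subseteq> {..<n}" for I and f :: "nat \<Rightarrow> int"
    using inj_on_subset[OF inj that] by (simp add: prod.reindex)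
  have sub: "{..<k} \<subseteq> {..<n}" using k by auto
  have "det_divisor (mat_diag n d) k = \<bar>\<Prod>i\<in>?r ` {..<k}. d i\<bar>"
  proof (rule det_divisor_mat_diag)
    show "?r ` {..<k} \<subseteq> {..<n}" using k by auto
    show "card (?r ` {..<k}) = k" using inj_on_subset[OF inj sub] by (simp add: card_image)
  next
    fix I assume I: "I \<subseteq> {..<n}" "card I = k"
    have "(\<Prod>i<card (?r ` I). d (?r i)) dvd (\<Prod>i\<in>?r ` I. d (?r i))"
      by (rule prod_initial_dvd[of n]) (use I in \<open>auto intro!: d\<close>)
    moreover have "card (?r ` I) = k" using inj_on_subset[OF inj I(1)] I by (simp add: card_image)
    moreover have "(\<Prod>i\<in>?r ` I. d (?r i)) = (\<Prod>i\<in>I. d i)"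
      unfolding reindex[OF I(1)] using I by (intro prod.cong) auto
    ultimately show "(\<Prod>i\<in>?r ` {..<k}. d i) dvd (\<Prod>i\<in>I. d i)" unfolding reindex[OF sub] by simp
  qed
  then show ?thesis unfolding reindex[OF sub] .
qed

section \<open>Unimodular equivalence\<close>

definition unimodular :: "nat \<Rightarrow> int mat set" where
  "unimodular n = {P \<in> carrier_mat n n. \<exists>P'\<in>carrier_mat n n. P * P' = 1\<^sub>m n \<and> P' * P = 1\<^sub>m n}"

lemma unimodularI:
  assumes "P \<in> carrier_mat n n" "P' \<in> carrier_mat n n" "P * P' = 1\<^sub>m n" "P' * P = 1\<^sub>m n"
  shows "P \<in> unimodular n"
  using assms unfolding unimodular_def by blast

lemma unimodular_carrier: "P \<in> unimodular n \<Longrightarrow> P \<in> carrier_mat n n"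
  by (simp add: unimodular_def)

lemma unimodularE:
  assumes "P \<in> unimodular n"
  obtains P' where "P' \<in> unimodular n" "P' \<in> carrier_mat n n" "P * P' = 1\<^sub>m n" "P' * P = 1\<^sub>m n"
  using assms unfolding unimodular_def by blast

lemma unimodular_Units: "P \<in> Units (ring_mat TYPE(int) n ()) \<Longrightarrow> P \<in> unimodular n"
  unfolding Units_def unimodular_def ring_mat_def by auto

lemma unimodular_one: "1\<^sub>m n \<in> unimodular n"
  by (rule unimodularI[of _ _ "1\<^sub>m n"]) auto

lemma mult_mat_cancel:
  fixes A B P P' :: "'a :: comm_ring_1 mat"
  assumes "A \<in> carrier_mat m n" "P \<in> carrier_mat n n" "P' \<in> carrier_mat n n" "P * P' = 1\<^sub>m n" "B \<in> carrier_mat n k"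
  shows "A * P * (P' * B) = A * B"
proof -
  have "A * P * (P' * B) = A * (P * (P' * B))" using assms by (intro assoc_mult_mat) auto
  also have "P * (P' * B) = P * P' * B" using assms by (intro assoc_mult_mat[symmetric]) auto
  finally show ?thesis using assms by simp
qed

lemma unimodular_mult:
  assumes "P \<in> unimodular n" "Q \<in> unimodular n"
  shows "P * Q \<in> unimodular n"
proof -
  obtain P' where P': "P' \<in> carrier_mat n n" "P * P' = 1\<^sub>m n" "P' * P = 1\<^sub>m n"
    using assms(1) by (rule unimodularE)
  obtain Q' where Q': "Q' \<in> carrier_mat n n" "Q * Q' = 1\<^sub>m n" "Q' * Q = 1\<^sub>m n"
    using assms(2) by (rule unimodularE)
  note C = assms[THEN unimodular_carrier]
  show ?thesis
    using C P' Q' mult_mat_cancel[of P n n Q Q' P' n] mult_mat_cancel[of Q' n n P' P Q n]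
    by (intro unimodularI[of _ _ "Q' * P'"]) auto
qed

lemma unimodular_transpose:
  assumes "P \<in> unimodular n"
  shows "transpose_mat P \<in> unimodular n"
proof -
  obtain P' where P': "P' \<in> carrier_mat n n" "P * P' = 1\<^sub>m n" "P' * P = 1\<^sub>m n"
    using assms by (rule unimodularE)
  note P = unimodular_carrier[OF assms]
  have "transpose_mat P * transpose_mat P' = transpose_mat (P' * P)"
    "transpose_mat P' * transpose_mat P = transpose_mat (P * P')"
    using transpose_mult[OF P P'(1)] transpose_mult[OF P'(1) P] by simp_all
  then show ?thesis using P P' by (intro unimodularI[of _ _ "transpose_mat P'"]) auto
qed

definition mat_equiv :: "nat \<Rightarrow> int mat \<Rightarrow> int mat \<Rightarrow> bool" where
  "mat_equiv n A B \<longleftrightarrow> (\<exists>P\<in>unimodular n. \<exists>Q\<in>unimodular n. B = P * A * Q)"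

lemma mat_equivI: "P \<in> unimodular n \<Longrightarrow> Q \<in> unimodular n \<Longrightarrow> B = P * A * Q \<Longrightarrow> mat_equiv n A B"
  unfolding mat_equiv_def by blast

lemma mat_equiv_carrier: "mat_equiv n A B \<Longrightarrow> B \<in> carrier_mat n n"
  unfolding mat_equiv_def using unimodular_carrier by force

lemma mat_equiv_refl: "A \<in> carrier_mat n n \<Longrightarrow> mat_equiv n A A"
  by (rule mat_equivI[OF unimodular_one unimodular_one]) auto

lemma mat_equiv_left: "A \<in> carrier_mat n n \<Longrightarrow> P \<in> unimodular n \<Longrightarrow> mat_equiv n A (P * A)"
  using unimodular_carrier[of P n] by (intro mat_equivI[OF _ unimodular_one]) auto

lemma mat_equiv_trans:
  assumes "A \<in> carrier_mat n n" "mat_equiv n A B" "mat_equiv n B C"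
  shows "mat_equiv n A C"
proof -
  obtain P Q where PQ: "P \<in> unimodular n" "Q \<in> unimodular n" "B = P * A * Q"
    using assms(2) unfolding mat_equiv_def by blast
  obtain P' Q' where PQ': "P' \<in> unimodular n" "Q' \<in> unimodular n" "C = P' * B * Q'"
    using assms(3) unfolding mat_equiv_def by blast
  note C = assms(1) PQ(1,2)[THEN unimodular_carrier] PQ'(1,2)[THEN unimodular_carrier]
  have "C = P' * (P * A * Q) * Q'" using PQ PQ' by simp
  also have "P' * (P * A * Q) = P' * P * A * Q"
    using C assoc_mult_mat[of P' n n "P * A" n Q n] assoc_mult_mat[of P' n n P n A n] by auto
  also have "P' * P * A * Q * Q' = P' * P * A * (Q * Q')"
    using C by (intro assoc_mult_mat) auto
  finally show ?thesis using PQ PQ' by (intro mat_equivI[of "P' * P" n "Q * Q'"] unimodular_mult)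
qed

lemma mat_equiv_transpose:
  assumes "A \<in> carrier_mat n n" "mat_equiv n A B"
  shows "mat_equiv n (transpose_mat A) (transpose_mat B)"
proof -
  obtain P Q where PQ: "P \<in> unimodular n" "Q \<in> unimodular n" "B = P * A * Q"
    using assms(2) unfolding mat_equiv_def by blast
  note C = assms(1) PQ(1,2)[THEN unimodular_carrier]
  have "transpose_mat B = transpose_mat Q * (transpose_mat A * transpose_mat P)"
    unfolding PQ using C by (simp add: transpose_mult[of _ n n _ n])
  also have "\<dots> = transpose_mat Q * transpose_mat A * transpose_mat P"
    using C by (intro assoc_mult_mat[symmetric]) auto
  finally show ?thesis using PQ unimodular_transpose by (intro mat_equivI) auto
qed

lemma mat_equiv_sym:
  assumes "A \<in> carrier_mat n n" "mat_equiv n A B"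
  shows "mat_equiv n B A"
proof -
  obtain P Q where PQ: "P \<in> unimodular n" "Q \<in> unimodular n" "B = P * A * Q"
    using assms(2) unfolding mat_equiv_def by blast
  obtain P' where P': "P' \<in> unimodular n" "P' \<in> carrier_mat n n" "P' * P = 1\<^sub>m n"
    using PQ(1) by (rule unimodularE)
  obtain Q' where Q': "Q' \<in> unimodular n" "Q' \<in> carrier_mat n n" "Q * Q' = 1\<^sub>m n"
    using PQ(2) by (rule unimodularE)
  note C = assms(1) PQ(1,2)[THEN unimodular_carrier] P'(2) Q'(2)
  have "P' * B * Q' = P' * (P * (A * Q)) * Q'"
    unfolding PQ using C by (simp add: assoc_mult_mat[of _ n n _ n _ n])
  also have "P' * (P * (A * Q)) = A * Q"
    using C P' assoc_mult_mat[of P' n n P n "A * Q" n] by simp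
  also have "A * Q * Q' = A" using C Q' by (simp add: assoc_mult_mat[of _ n n _ n _ n])
  finally show ?thesis by (rule mat_equivI[OF P'(1) Q'(1) sym])
qed

lemma det_divisor_mat_equiv:
  assumes "A \<in> carrier_mat n n" "mat_equiv n A B"
  shows "det_divisor B k = det_divisor A k"
proof (rule associated_eqI)
  have dvd: "det_divisor A k dvd det_divisor B k" if "A \<in> carrier_mat n n" "mat_equiv n A B" for A B
    using that det_divisor_dvd_det_divisor_mult[of _ n n A n _ n] unimodular_carrier
    unfolding mat_equiv_def by blast
  show "det_divisor A k dvd det_divisor B k" by (rule dvd[OF assms])
  show "det_divisor B k dvd det_divisor A k"
    by (rule dvd[OF mat_equiv_carrier[OF assms(2)] mat_equiv_sym[OF assms]])
qed (rule normalize_det_divisor)+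

section \<open>The Smith normal form\<close>

text \<open>
  A pivot of least absolute value among the nonzero entries of all equivalent matrices.  Such a pivot
  replaces the termination argument of the elimination algorithm: an entry that it failed to divide
  would leave a smaller nonzero remainder in an equivalent matrix.
\<close>

definition minimal_pivot :: "nat \<Rightarrow> int mat \<Rightarrow> bool" where
  "minimal_pivot n A \<longleftrightarrow> A \<in> carrier_mat n n \<and> A $$ (0, 0) \<noteq> 0 \<and>
     (\<forall>B i j. mat_equiv n A B \<longrightarrow> i < n \<longrightarrow> j < n \<longrightarrow> B $$ (i, j) \<noteq> 0 \<longrightarrow> \<bar>A $$ (0, 0)\<bar> \<le> \<bar>B $$ (i, j)\<bar>)"

lemma minimal_pivot_mat_equiv:
  assumes "minimal_pivot n A" "mat_equiv n A B" "B $$ (0, 0) = A $$ (0, 0)"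
  shows "minimal_pivot n B"
  using assms mat_equiv_carrier[OF assms(2)] mat_equiv_trans[of A n B]
  unfolding minimal_pivot_def by metis

lemma minimal_pivot_transpose:
  assumes "minimal_pivot n A" "0 < n"
  shows "minimal_pivot n (transpose_mat A)"
  unfolding minimal_pivot_def
proof (intro conjI allI impI)
  have A: "A \<in> carrier_mat n n" using assms by (simp add: minimal_pivot_def)
  then show "transpose_mat A \<in> carrier_mat n n" by simp
  show "transpose_mat A $$ (0, 0) \<noteq> 0" using A assms by (simp add: minimal_pivot_def)
  fix B i j assume B: "mat_equiv n (transpose_mat A) B" and ij: "i < n" "j < n" "B $$ (i, j) \<noteq> 0"
  have "mat_equiv n A (transpose_mat B)" using mat_equiv_transpose[OF _ B] A by simp
  moreover have "transpose_mat B $$ (j, i) = B $$ (i, j)" using ij mat_equiv_carrier[OF B] by simp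
  ultimately have "\<bar>A $$ (0, 0)\<bar> \<le> \<bar>B $$ (i, j)\<bar>"
    using assms(1) ij unfolding minimal_pivot_def by metis
  then show "\<bar>transpose_mat A $$ (0, 0)\<bar> \<le> \<bar>B $$ (i, j)\<bar>" using A assms by simp
qed

lemma mat_equiv_addrow:
  assumes "A \<in> carrier_mat n n" "k < n" "l < n" "k \<noteq> l"
  shows "mat_equiv n A (addrow a k l A)"
  unfolding addrow_mat[OF assms(1,3)]
  by (intro mat_equiv_left unimodular_Units addrow_mat_Unit assms)

lemma mat_equiv_swaprows:
  assumes "A \<in> carrier_mat n n" "k < n" "l < n"
  shows "mat_equiv n A (swaprows k l A)"
  unfolding swaprows_mat[OF assms]
  by (intro mat_equiv_left unimodular_Units swaprows_mat_Unit assms)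

text \<open>
  Division with remainder, carried out as a row operation, would otherwise produce a smaller entry.
\<close>

lemma minimal_pivot_dvd_column:
  assumes "minimal_pivot n A" "i < n"
  shows "A $$ (0, 0) dvd A $$ (i, 0)"
proof (cases "i = 0")
  case False
  have A: "A \<in> carrier_mat n n" using assms by (simp add: minimal_pivot_def)
  define b where "b = A $$ (0, 0)"
  have b: "b \<noteq> 0" using assms by (simp add: b_def minimal_pivot_def)
  define B where "B = addrow (- (A $$ (i, 0) div b)) i 0 A"
  have "B $$ (i, 0) = A $$ (i, 0) mod b"
    using A assms(2) by (simp add: B_def b_def minus_div_mult_eq_mod[symmetric])
  moreover have "mat_equiv n A B" unfolding B_def using A assms(2) False by (intro mat_equiv_addrow) auto
  ultimately have "A $$ (i, 0) mod b \<noteq> 0 \<longrightarrow> \<bar>b\<bar> \<le> \<bar>A $$ (i, 0) mod b\<bar>"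
    using assms unfolding minimal_pivot_def b_def by (metis less_nat_zero_code not_gr_zero)
  then show ?thesis using abs_mod_less[OF b, of "A $$ (i, 0)"] by (auto simp: b_def dvd_eq_mod_eq_0)
qed simp

lemma minimal_pivot_dvd_row:
  assumes "minimal_pivot n A" "j < n"
  shows "A $$ (0, 0) dvd A $$ (0, j)"
proof -
  have "A \<in> carrier_mat n n" using assms by (simp add: minimal_pivot_def)
  then show ?thesis
    using minimal_pivot_dvd_column[OF minimal_pivot_transpose[OF assms(1)] assms(2)] assms(2) by simp
qed

lemma minimal_pivot_exists:
  assumes A: "A \<in> carrier_mat n n" and nz: "A \<noteq> 0\<^sub>m n n"
  obtains B where "mat_equiv n A B" "minimal_pivot n B"
proof -
  define S where "S = {(B, i, j). mat_equiv n A B \<and> i < n \<and> j < n \<and> B $$ (i, j) \<noteq> 0}"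
  obtain i0 j0 where "i0 < n" "j0 < n" "A $$ (i0, j0) \<noteq> 0"
    using nz A by (metis carrier_matD eq_matI index_zero_mat)
  then have "(A, i0, j0) \<in> S" using mat_equiv_refl[OF A] by (simp add: S_def)
  then obtain m where "m \<in> S" and min: "\<And>x. x \<in> S \<Longrightarrow>
      (case m of (B, i, j) \<Rightarrow> nat \<bar>B $$ (i, j)\<bar>) \<le> (case x of (B, i, j) \<Rightarrow> nat \<bar>B $$ (i, j)\<bar>)"
    using ex_has_least_nat[of "\<lambda>x. x \<in> S" _ "\<lambda>(B, i, j). nat \<bar>B $$ (i, j)\<bar>"] by blast
  obtain B i j where m: "m = (B, i, j)" by (cases m)
  have B: "mat_equiv n A B" "i < n" "j < n" "B $$ (i, j) \<noteq> 0" using \<open>m \<in> S\<close> by (auto simp: S_def m)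
  have le: "\<bar>B $$ (i, j)\<bar> \<le> \<bar>C $$ (k, l)\<bar>"
    if "mat_equiv n A C" "k < n" "l < n" "C $$ (k, l) \<noteq> 0" for C k l
    using min[of "(C, k, l)"] that by (simp add: S_def m)
  have Bc: "B \<in> carrier_mat n n" using B mat_equiv_carrier by blast
  \<comment> \<open>Move the minimal entry to the top left corner, exchanging columns through the transpose.\<close>
  define C where "C = transpose_mat (swaprows 0 j (transpose_mat (swaprows 0 i B)))"
  have "mat_equiv n (transpose_mat (swaprows 0 i B)) (swaprows 0 j (transpose_mat (swaprows 0 i B)))"
    using Bc B by (intro mat_equiv_swaprows) auto
  from mat_equiv_transpose[OF _ this] have "mat_equiv n (swaprows 0 i B) C"
    using Bc unfolding C_def by simp
  then have "mat_equiv n B C" using mat_equiv_trans[OF Bc mat_equiv_swaprows[OF Bc, of 0 i]] B by auto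
  then have AC: "mat_equiv n A C" by (rule mat_equiv_trans[OF A B(1)])
  have C00: "C $$ (0, 0) = B $$ (i, j)" using Bc B by (auto simp: C_def)
  have "minimal_pivot n C"
    unfolding minimal_pivot_def C00 using B le mat_equiv_trans[OF A AC] mat_equiv_carrier[OF AC] by blast
  with AC show ?thesis by (rule that)
qed

text \<open>
  The block diagonal matrix with blocks \<open>b\<close> and \<open>D\<close>.
\<close>

definition corner :: "int \<Rightarrow> int mat \<Rightarrow> int mat" where
  "corner b D = four_block_mat (mat 1 1 (\<lambda>_. b)) (0\<^sub>m 1 (dim_col D)) (0\<^sub>m (dim_row D) 1) D"

lemma corner_carrier: "D \<in> carrier_mat n n \<Longrightarrow> corner b D \<in> carrier_mat (Suc n) (Suc n)"
  unfolding corner_def using four_block_carrier_mat[of "mat 1 1 (\<lambda>_. b)" 1 1 D n n] by simp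

lemma corner_mult:
  assumes "D \<in> carrier_mat n n" "E \<in> carrier_mat n n"
  shows "corner b D * corner c E = corner (b * c) (D * E)"
proof -
  have "mat 1 1 (\<lambda>_. b) * mat 1 1 (\<lambda>_. c) = mat 1 1 (\<lambda>_. b * c)"
    by (rule eq_matI) (auto simp: scalar_prod_def)
  then show ?thesis
    unfolding corner_def using assms
    by (subst mult_four_block_mat[of _ 1 1 _ n _ n _ _ 1 _ n]) auto
qed

lemma corner_one: "corner 1 (1\<^sub>m n) = 1\<^sub>m (Suc n)"
  unfolding corner_def by (rule eq_matI) auto

lemma unimodular_corner:
  assumes "P \<in> unimodular n"
  shows "corner 1 P \<in> unimodular (Suc n)"
proof -
  obtain P' where P': "P' \<in> carrier_mat n n" "P * P' = 1\<^sub>m n" "P' * P = 1\<^sub>m n"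
    using assms by (rule unimodularE)
  note P = unimodular_carrier[OF assms]
  show ?thesis
    using P P' by (intro unimodularI[of _ _ "corner 1 P'"]) (auto simp: corner_carrier corner_mult corner_one)
qed

lemma mat_equiv_corner:
  assumes "D \<in> carrier_mat n n" "mat_equiv n D E"
  shows "mat_equiv (Suc n) (corner b D) (corner b E)"
proof -
  obtain P Q where PQ: "P \<in> unimodular n" "Q \<in> unimodular n" "E = P * D * Q"
    using assms(2) unfolding mat_equiv_def by blast
  have "corner b E = corner 1 P * corner b D * corner 1 Q"
    using assms(1) PQ unimodular_carrier[OF PQ(1)] unimodular_carrier[OF PQ(2)]
    by (simp add: corner_mult[of P n D] corner_mult[of "P * D" n Q])
  then show ?thesis by (rule mat_equivI[OF unimodular_corner[OF PQ(1)] unimodular_corner[OF PQ(2)]])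
qed

text \<open>
  As the pivot divides its row and column, both are cleared at once by the unipotent block matrices
  \<open>L\<close> and \<open>U\<close>; their inverses arise by negating the off-diagonal block, hence the sign
  parameter \<open>s\<close> in their definition.
\<close>

lemma minimal_pivot_split:
  assumes min: "minimal_pivot (Suc n) A"
  obtains D where "D \<in> carrier_mat n n" "mat_equiv (Suc n) A (corner (A $$ (0, 0)) D)"
proof -
  define b where "b = A $$ (0, 0)"
  have A: "A \<in> carrier_mat (Suc n) (Suc n)" using min by (simp add: minimal_pivot_def)
  have row: "b * (A $$ (0, j) div b) = A $$ (0, j)" if "j < Suc n" for j
    using minimal_pivot_dvd_row[OF min that] by (simp add: b_def)
  have col: "b * (A $$ (i, 0) div b) = A $$ (i, 0)" if "i < Suc n" for i
    using minimal_pivot_dvd_column[OF min that] by (simp add: b_def)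
  define I :: "int mat" where "I = 1\<^sub>m n"
  define one :: "int mat" where "one = 1\<^sub>m 1"
  define R where "R = mat 1 n (\<lambda>(i, j). A $$ (0, Suc j) div b)"
  define C where "C = mat n 1 (\<lambda>(i, j). A $$ (Suc i, 0) div b)"
  define L where "L s = four_block_mat one (0\<^sub>m 1 n) (s \<cdot>\<^sub>m C) I" for s :: int
  define U where "U s = four_block_mat one (s \<cdot>\<^sub>m R) (0\<^sub>m n 1) I" for s :: int
  have c: "I \<in> carrier_mat n n" "one \<in> carrier_mat 1 1" "R \<in> carrier_mat 1 n" "C \<in> carrier_mat n 1"
    by (auto simp: I_def one_def R_def C_def)
  have zero: "0 \<cdot>\<^sub>m C = 0\<^sub>m n 1" "0 \<cdot>\<^sub>m R = 0\<^sub>m 1 n" by (auto simp: C_def R_def)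
  have L1: "L s * L t = 1\<^sub>m (Suc n)" if "s + t = 0" for s t
  proof -
    have "L s * L t = four_block_mat one (0\<^sub>m 1 n) ((s + t) \<cdot>\<^sub>m C) I"
      unfolding L_def using c
      by (subst mult_four_block_mat[of _ 1 1 _ n _ n _ _ 1 _ n]) (auto simp: I_def one_def add_smult_distrib_right_mat)
    then show ?thesis using that zero four_block_one_mat[of 1 n] by (simp add: I_def one_def)
  qed
  have U1: "U s * U t = 1\<^sub>m (Suc n)" if "s + t = 0" for s t
  proof -
    have "U s * U t = four_block_mat one ((t + s) \<cdot>\<^sub>m R) (0\<^sub>m n 1) I"
      unfolding U_def using c
      by (subst mult_four_block_mat[of _ 1 1 _ n _ n _ _ 1 _ n]) (auto simp: I_def one_def add_smult_distrib_right_mat)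
    then show ?thesis using that zero four_block_one_mat[of 1 n] by (simp add: I_def one_def add.commute)
  qed
  have Lc: "L s \<in> carrier_mat (Suc n) (Suc n)" and Uc: "U s \<in> carrier_mat (Suc n) (Suc n)" for s
    using four_block_carrier_mat[OF c(2) c(1)] by (auto simp: L_def U_def)
  have un: "L 1 \<in> unimodular (Suc n)" "U 1 \<in> unimodular (Suc n)"
    using L1 U1 Lc Uc by (auto intro: unimodularI[of _ _ "L (-1)"] unimodularI[of _ _ "U (-1)"])
  define D where "D = mat n n (\<lambda>(i, j). A $$ (Suc i, Suc j) - C $$ (i, 0) * b * R $$ (0, j))"
  have D: "D \<in> carrier_mat n n" by (simp add: D_def)
  define m where "m = mat 1 1 (\<lambda>_. b)"
  have m: "m \<in> carrier_mat 1 1" by (simp add: m_def)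
  have smult: "1 \<cdot>\<^sub>m C = C" "1 \<cdot>\<^sub>m R = R" by auto
  have "L 1 * corner b D = four_block_mat m (0\<^sub>m 1 n) (C * m) D"
    unfolding L_def smult corner_def m_def[symmetric] using c D m
    by (subst mult_four_block_mat[of _ 1 1 _ n _ n _ _ 1 _ n]) (auto simp: I_def one_def)
  also have "\<dots> * U 1 = four_block_mat m (m * R) (C * m) (C * m * R + D)"
    unfolding U_def smult using c D m
    by (subst mult_four_block_mat[of _ 1 1 _ n _ n _ _ 1 _ n]) (auto simp: I_def one_def)
  also have "\<dots> = A"
  proof (rule eq_matI)
    fix i j assume "i < dim_row A" "j < dim_col A"
    then have ij: "i < Suc n" "j < Suc n" using A by auto
    have "m $$ (0, 0) = b" by (simp add: m_def)
    then show "four_block_mat m (m * R) (C * m) (C * m * R + D) $$ (i, j) = A $$ (i, j)"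
      using ij A c m D row[of j] col[of i]
      by (cases i; cases j) (auto simp: b_def scalar_prod_def D_def R_def C_def mult.commute)
  qed (use A m c D in auto)
  finally have "A = L 1 * corner b D * U 1" by simp
  then have "mat_equiv (Suc n) (corner b D) A" by (rule mat_equivI[OF un])
  then have "mat_equiv (Suc n) A (corner b D)" by (rule mat_equiv_sym[OF corner_carrier[OF D]])
  then show ?thesis using that[OF D] by (simp add: b_def)
qed

text \<open>
  Adding row \<open>Suc i\<close> to row \<open>0\<close> leaves the pivot in place and puts row \<open>i\<close> of \<open>D\<close> next to it,
  where the pivot has to divide it.
\<close>

lemma minimal_pivot_dvd_corner:
  assumes min: "minimal_pivot (Suc n) (corner b D)" and D: "D \<in> carrier_mat n n" and ij: "i < n" "j < n"
  shows "b dvd D $$ (i, j)"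
proof -
  define B where "B = addrow 1 0 (Suc i) (corner b D)"
  have c: "corner b D \<in> carrier_mat (Suc n) (Suc n)" by (rule corner_carrier[OF D])
  have "mat_equiv (Suc n) (corner b D) B" unfolding B_def using c ij by (intro mat_equiv_addrow) auto
  moreover have B00: "B $$ (0, 0) = b" "corner b D $$ (0, 0) = b" using c D ij by (auto simp: B_def corner_def)
  ultimately have "minimal_pivot (Suc n) B" using minimal_pivot_mat_equiv[OF min] by simp
  then have "B $$ (0, 0) dvd B $$ (0, Suc j)" using ij by (intro minimal_pivot_dvd_row) auto
  moreover have "B $$ (0, Suc j) = D $$ (i, j)" using c D ij by (auto simp: B_def corner_def)
  ultimately show ?thesis using B00 by simp
qed

lemma mat_equiv_dvd_entries:
  assumes A: "A \<in> carrier_mat n n" and eq: "mat_equiv n A B"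
    and dvd: "\<And>i j. i < n \<Longrightarrow> j < n \<Longrightarrow> b dvd A $$ (i, j)" and ij: "i < n" "j < n"
  shows "b dvd B $$ (i, j)"
proof -
  obtain P Q where PQ: "P \<in> unimodular n" "Q \<in> unimodular n" "B = P * A * Q"
    using eq unfolding mat_equiv_def by blast
  note C = PQ(1,2)[THEN unimodular_carrier]
  have "b dvd (P * A) $$ (i, j)" if "j < n" for j
    using that C A ij dvd by (auto simp: scalar_prod_def intro!: dvd_sum)
  moreover have "B $$ (i, j) = (\<Sum>l = 0..<n. (P * A) $$ (i, l) * Q $$ (l, j))"
    unfolding PQ(3) using C A ij by (subst index_mult_mat) (auto simp: scalar_prod_def)
  ultimately show ?thesis by (auto intro!: dvd_sum dvd_mult2)
qed

text \<open>
  Induction on the size: split off a minimal pivot, which divides all entries of the remaining block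
  and therefore all its elementary divisors.
\<close>

theorem smith_normal_form_exists:
  assumes "A \<in> carrier_mat n n"
  shows "\<exists>d. mat_equiv n A (mat_diag n d) \<and> (\<forall>i j. i \<le> j \<longrightarrow> j < n \<longrightarrow> d i dvd d j)"
  using assms
proof (induction n arbitrary: A)
  case 0
  then have "A = mat_diag 0 (\<lambda>_. 0)" by (intro eq_matI) (auto simp: mat_diag_def)
  then show ?case using mat_equiv_refl[OF 0] by (intro exI[of _ "\<lambda>_. 0"]) auto
next
  case (Suc n)
  show ?case
  proof (cases "A = 0\<^sub>m (Suc n) (Suc n)")
    case True
    then have "A = mat_diag (Suc n) (\<lambda>_. 0)" by (intro eq_matI) (auto simp: mat_diag_def)
    then show ?thesis using mat_equiv_refl[OF Suc.prems] by (intro exI[of _ "\<lambda>_. 0"]) auto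
  next
    case False
    obtain B where B: "mat_equiv (Suc n) A B" "minimal_pivot (Suc n) B"
      by (rule minimal_pivot_exists[OF Suc.prems False])
    obtain D where D: "D \<in> carrier_mat n n" "mat_equiv (Suc n) B (corner (B $$ (0, 0)) D)"
      by (rule minimal_pivot_split[OF B(2)])
    define b where "b = B $$ (0, 0)"
    have "minimal_pivot (Suc n) (corner b D)"
      using minimal_pivot_mat_equiv[OF B(2) D(2)] D(1) by (simp add: b_def corner_def)
    then have dvd: "b dvd D $$ (i, j)" if "i < n" "j < n" for i j
      using minimal_pivot_dvd_corner D(1) that by blast
    obtain d where d: "mat_equiv n D (mat_diag n d)" "\<And>i j. i \<le> j \<Longrightarrow> j < n \<Longrightarrow> d i dvd d j"
      using Suc.IH[OF D(1)] by blast
    define d' where "d' i = (case i of 0 \<Rightarrow> b | Suc i \<Rightarrow> d i)" for i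
    have "mat_equiv (Suc n) A (corner b D)"
      using mat_equiv_trans[OF Suc.prems B(1) D(2)] by (simp add: b_def)
    then have "mat_equiv (Suc n) A (corner b (mat_diag n d))"
      using mat_equiv_trans[OF Suc.prems] mat_equiv_corner[OF D(1) d(1)] by blast
    also have "corner b (mat_diag n d) = mat_diag (Suc n) d'"
      by (rule eq_matI) (auto simp: corner_def mat_diag_def d'_def split: nat.splits)
    finally have "mat_equiv (Suc n) A (mat_diag (Suc n) d')" .
    moreover have "b dvd d j" if "j < n" for j
      using mat_equiv_dvd_entries[OF D(1) d(1) dvd that that] that by (simp add: mat_diag_def)
    then have "d' i dvd d' j" if "i \<le> j" "j < Suc n" for i j
      using that d(2) by (auto simp: d'_def split: nat.splits)
    ultimately show ?thesis by blast
  qed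
qed

section \<open>The symmetry of the elementary divisors\<close>

text \<open>
  With \<open>D = P M Q\<close>, the matrix \<open>E = Q\<inverse> M\<^sup>T P\<inverse>\<close> satisfies \<open>D E = c\<close>, so it is
  diagonal with entries \<open>c / d i\<close>, a divisor chain in the reverse direction.  As \<open>E\<close> is
  equivalent to the transpose of \<open>M\<close>, it has the determinantal divisors of \<open>D\<close>.  Comparing these for
  consecutive orders identifies, up to sign, the entries of \<open>D\<close> with those of \<open>E\<close> read backwards.
\<close>

lemma abs_mult_reversed_diagonal:
  fixes d :: "nat \<Rightarrow> int"
  assumes M: "M \<in> carrier_mat n n" and MM: "M * transpose_mat M = c \<cdot>\<^sub>m 1\<^sub>m n" and c: "c \<noteq> 0"
    and eq: "mat_equiv n M (mat_diag n d)" and d: "\<And>i j. i \<le> j \<Longrightarrow> j < n \<Longrightarrow> d i dvd d j"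
    and i: "i < n"
  shows "\<bar>d i\<bar> * \<bar>d (n - 1 - i)\<bar> = \<bar>c\<bar>"
proof -
  obtain P Q where PQ: "P \<in> unimodular n" "Q \<in> unimodular n" and D: "mat_diag n d = P * M * Q"
    using eq unfolding mat_equiv_def by blast
  obtain P' where P': "P' \<in> unimodular n" "P' \<in> carrier_mat n n" "P * P' = 1\<^sub>m n"
    using PQ(1) by (rule unimodularE)
  obtain Q' where Q': "Q' \<in> unimodular n" "Q' \<in> carrier_mat n n" "Q * Q' = 1\<^sub>m n"
    using PQ(2) by (rule unimodularE)
  note C = PQ(1,2)[THEN unimodular_carrier] P'(2) Q'(2) M
  define E where "E = Q' * transpose_mat M * P'"
  have E: "E \<in> carrier_mat n n" using C by (simp add: E_def)
  have "mat_equiv n (transpose_mat M) E" using mat_equivI[OF Q'(1) P'(1) E_def] .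
  then have "det_divisor E k = det_divisor (mat_diag n d) k" for k
    using det_divisor_mat_equiv[OF M eq] det_divisor_mat_equiv[of "transpose_mat M" n E] M
    by (simp add: det_divisor_transpose)
  moreover have DE: "mat_diag n d * E = c \<cdot>\<^sub>m 1\<^sub>m n"
  proof -
    have "mat_diag n d * E = P * M * Q * (Q' * (transpose_mat M * P'))"
      unfolding D E_def using C by (simp add: assoc_mult_mat[of Q' n n _ n _ n])
    also have "\<dots> = P * M * (transpose_mat M * P')"
      using C Q' by (intro mult_mat_cancel) auto
    also have "\<dots> = P * (M * transpose_mat M) * P'"
      using C by (simp add: assoc_mult_mat[of _ n n _ n _ n])
    also have "\<dots> = c \<cdot>\<^sub>m (P * P')"
      unfolding MM using C mult_smult_distrib[of P n n "1\<^sub>m n" n c] mult_smult_assoc_mat[of P n n P' n c]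
      by simp
    finally show ?thesis using P' by simp
  qed
  have entry: "d i * E $$ (i, j) = (if i = j then c else 0)" if "i < n" "j < n" for i j
  proof -
    have "(mat_diag n d * E) $$ (i, j) = d i * E $$ (i, j)"
      using that E by (simp add: mat_diag_mult_left)
    then show ?thesis using that by (cases "i = j") (simp_all add: DE)
  qed
  have d0: "d i \<noteq> 0" if "i < n" for i using entry[OF that that] c by auto
  define e where "e i = E $$ (i, i)" for i
  have de: "d i * e i = c" if "i < n" for i using entry[OF that that] by (simp add: e_def)
  have "E = mat_diag n e"
  proof (rule eq_matI)
    fix i j assume "i < dim_row (mat_diag n e)" "j < dim_col (mat_diag n e)"
    then have ij: "i < n" "j < n" by (auto simp: mat_diag_def)
    then show "E $$ (i, j) = mat_diag n e $$ (i, j)"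
      using entry[OF ij] d0[of i] by (auto simp: mat_diag_def e_def)
  qed (use E in \<open>auto simp: mat_diag_def\<close>)
  moreover have "e j dvd e i" if ij: "i \<le> j" "j < n" for i j
  proof -
    obtain l where l: "d j = d i * l" using d[OF ij] by (elim dvdE)
    have "d i * e i = d i * (l * e j)" using de[of i] de[of j] ij l by simp
    then show ?thesis using d0[of i] ij by simp
  qed
  ultimately have prods: "\<bar>\<Prod>i<k. e (n - 1 - i)\<bar> = \<bar>\<Prod>i<k. d i\<bar>" if "k \<le> n" for k
    using det_divisor_reversed_divisor_chain[of n e k] det_divisor_divisor_chain[of n d k] d that by simp
  have "\<bar>\<Prod>i<i. d i\<bar> \<noteq> 0" using d0 i by (auto simp: less_trans)
  moreover have "\<bar>\<Prod>i<i. d i\<bar> * \<bar>e (n - 1 - i)\<bar> = \<bar>\<Prod>i<i. d i\<bar> * \<bar>d i\<bar>"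
    using prods[of "Suc i"] prods[of i] i by (simp add: abs_mult)
  ultimately have "\<bar>e (n - 1 - i)\<bar> = \<bar>d i\<bar>" by simp
  moreover have "\<bar>d (n - 1 - i)\<bar> * \<bar>e (n - 1 - i)\<bar> = \<bar>c\<bar>"
    using de[of "n - 1 - i"] i by (simp add: abs_mult[symmetric])
  ultimately show ?thesis by (simp add: mult.commute)
qed

section \<open>The coincidence index from the elementary divisors\<close>

lemma div_gcd_dvd_iff:
  fixes q d x :: int
  assumes "q \<noteq> 0"
  shows "q div gcd q d dvd x \<longleftrightarrow> q dvd d * x"
proof -
  define g where "g = gcd q d"
  have g: "g \<noteq> 0" using assms by (simp add: g_def)
  obtain a b where ab: "q = a * g" "d = b * g" "coprime a b"
    using gcd_coprime_exists[of q d] g unfolding g_def by blast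
  have "q dvd d * x \<longleftrightarrow> a dvd b * x"
    using g by (simp add: ab(1,2) mult.assoc mult.left_commute[of _ g] mult.commute[of _ g])
  also have "\<dots> \<longleftrightarrow> a dvd x" using ab(3) by (rule coprime_dvd_mult_right_iff)
  also have "a = q div g" using g by (simp add: ab(1))
  finally show ?thesis by (simp add: g_def)
qed

lemma dvd_mult_mat_vec:
  fixes A :: "int mat"
  assumes "A \<in> carrier_mat m n" "u \<in> carrier_vec n" "\<And>i. i < n \<Longrightarrow> q dvd u $ i" "i < m"
  shows "q dvd (A *\<^sub>v u) $ i"
  using assms by (auto simp: scalar_prod_def intro!: dvd_sum)

text \<open>
  The residues of the transformed coordinates.  They label the cosets of the coincidence lattice when
  \<open>U\<close> and the moduli \<open>e\<close> come from the normal form.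
\<close>

definition residue_vec :: "int mat \<Rightarrow> nat \<Rightarrow> (nat \<Rightarrow> int) \<Rightarrow> int vec \<Rightarrow> nat \<Rightarrow> int" where
  "residue_vec U n e w = (\<lambda>i\<in>{..<n}. (U *\<^sub>v w) $ i mod e i)"

lemma residue_vec_eq_iff:
  assumes U: "U \<in> carrier_mat n n" and w: "w \<in> carrier_vec n" "w' \<in> carrier_vec n"
  shows "residue_vec U n e w = residue_vec U n e w' \<longleftrightarrow> (\<forall>i<n. e i dvd (U *\<^sub>v (w - w')) $ i)"
proof -
  have "residue_vec U n e w = residue_vec U n e w' \<longleftrightarrow>
      (\<forall>i<n. (U *\<^sub>v w) $ i mod e i = (U *\<^sub>v w') $ i mod e i)"
    by (auto simp: residue_vec_def fun_eq_iff restrict_def)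
  also have "\<dots> \<longleftrightarrow> (\<forall>i<n. e i dvd (U *\<^sub>v w) $ i - (U *\<^sub>v w') $ i)"
    by (simp add: mod_eq_dvd_iff)
  finally show ?thesis using U w by (simp add: mult_minus_distrib_mat_vec)
qed

text \<open>
  Every family of residues occurs, because \<open>U\<close> is invertible over the integers.
\<close>

lemma image_residue_vec:
  assumes U: "U \<in> unimodular n" and e: "\<And>i. i < n \<Longrightarrow> 0 < e i"
  shows "residue_vec U n e ` carrier_vec n = (\<Pi>\<^sub>E i\<in>{..<n}. {0..<e i})"
proof (rule subset_antisym)
  show "residue_vec U n e ` carrier_vec n \<subseteq> (\<Pi>\<^sub>E i\<in>{..<n}. {0..<e i})"
    using e by (auto simp: residue_vec_def split: if_splits)
  obtain U' where U': "U' \<in> carrier_mat n n" "U * U' = 1\<^sub>m n"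
    using U by (rule unimodularE)
  show "(\<Pi>\<^sub>E i\<in>{..<n}. {0..<e i}) \<subseteq> residue_vec U n e ` carrier_vec n"
  proof
    fix r assume r: "r \<in> (\<Pi>\<^sub>E i\<in>{..<n}. {0..<e i})"
    have "U *\<^sub>v (U' *\<^sub>v vec n r) = vec n r"
      using U' unimodular_carrier[OF U] by (simp add: assoc_mult_mat_vec[symmetric])
    then have "residue_vec U n e (U' *\<^sub>v vec n r) = r"
      using r by (intro ext) (auto simp: residue_vec_def PiE_iff extensional_def)
    moreover have "U' *\<^sub>v vec n r \<in> carrier_vec n" using U' by simp
    ultimately show "r \<in> residue_vec U n e ` carrier_vec n" by (metis image_eqI)
  qed
qed

text \<open>
  The condition that \<open>q\<close> divides every entry is not affected by the invertible matrix \<open>P\<close>, and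
  \<open>P * M = D * Q\<inverse>\<close>.
\<close>

lemma diagonalised_dvd_iff:
  fixes q :: int
  assumes M: "M \<in> carrier_mat n n" and P: "P \<in> unimodular n" and Q: "Q \<in> unimodular n"
    and Q': "Q' \<in> carrier_mat n n" "Q * Q' = 1\<^sub>m n"
    and D: "mat_diag n d = P * M * Q" and u: "u \<in> carrier_vec n" and q: "q \<noteq> 0"
  shows "(\<forall>i<n. q dvd (M *\<^sub>v u) $ i) \<longleftrightarrow> (\<forall>i<n. q div gcd q (d i) dvd (Q' *\<^sub>v u) $ i)"
proof -
  obtain P' where P': "P' \<in> carrier_mat n n" "P' * P = 1\<^sub>m n" using P by (rule unimodularE)
  note C = M P[THEN unimodular_carrier] Q[THEN unimodular_carrier] Q' P' u
  have "mat_diag n d * Q' = P * M * (Q * Q')"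
    unfolding D using C by (intro assoc_mult_mat) auto
  then have PM: "P * M = mat_diag n d * Q'" using C by simp
  have Mu: "M *\<^sub>v u \<in> carrier_vec n" using C by simp
  have PMu: "P *\<^sub>v (M *\<^sub>v u) = mat_diag n d *\<^sub>v (Q' *\<^sub>v u)"
    using C PM assoc_mult_mat_vec[of P n n M n u] assoc_mult_mat_vec[of "mat_diag n d" n n Q' n u] by simp
  have inv: "P' *\<^sub>v (P *\<^sub>v (M *\<^sub>v u)) = M *\<^sub>v u"
    using C Mu assoc_mult_mat_vec[of P' n n P n "M *\<^sub>v u"] by simp
  have "(mat_diag n d *\<^sub>v (Q' *\<^sub>v u)) $ i = d i * (Q' *\<^sub>v u) $ i" if "i < n" for i
  proof -
    define y where "y = Q' *\<^sub>v u"
    have y: "y \<in> carrier_vec n" using C by (simp add: y_def)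
    have "(mat_diag n d *\<^sub>v y) $ i = (\<Sum>j = 0..<n. if i = j then d j * y $ j else 0)"
      using that y by (simp add: mat_diag_def scalar_prod_def if_distrib[of "\<lambda>x. x * _"] cong: if_cong)
    then show ?thesis using that by (simp add: y_def)
  qed
  then have "(\<forall>i<n. q dvd (P *\<^sub>v (M *\<^sub>v u)) $ i) \<longleftrightarrow> (\<forall>i<n. q div gcd q (d i) dvd (Q' *\<^sub>v u) $ i)"
    unfolding PMu using div_gcd_dvd_iff[OF q] by simp
  moreover have "(\<forall>i<n. q dvd (P *\<^sub>v (M *\<^sub>v u)) $ i) \<longleftrightarrow> (\<forall>i<n. q dvd (M *\<^sub>v u) $ i)"
  proof
    assume "\<forall>i<n. q dvd (P *\<^sub>v (M *\<^sub>v u)) $ i"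
    then have "q dvd (P' *\<^sub>v (P *\<^sub>v (M *\<^sub>v u))) $ i" if "i < n" for i
      using that C by (intro dvd_mult_mat_vec[of P' n n]) auto
    then show "\<forall>i<n. q dvd (M *\<^sub>v u) $ i" unfolding inv by blast
  next
    assume "\<forall>i<n. q dvd (M *\<^sub>v u) $ i"
    then show "\<forall>i<n. q dvd (P *\<^sub>v (M *\<^sub>v u)) $ i"
      using C by (auto intro!: dvd_mult_mat_vec[of P n n] simp del: index_mult_mat_vec)
  qed
  ultimately show ?thesis by simp
qed

lemma card_image_cong_fibres:
  assumes "\<And>x y. x \<in> A \<Longrightarrow> y \<in> A \<Longrightarrow> f x = f y \<longleftrightarrow> g x = g y"
  shows "card (f ` A) = card (g ` A)"
proof (rule bij_betw_same_card)
  show "bij_betw (\<lambda>z. g (inv_into A f z)) (f ` A) (g ` A)"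
  proof (rule bij_betw_imageI)
    have inv: "inv_into A f (f x) \<in> A" "f (inv_into A f (f x)) = f x" if "x \<in> A" for x
      using that by (auto intro: inv_into_into f_inv_into_f)
    have g: "g (inv_into A f (f x)) = g x" if "x \<in> A" for x using assms[OF inv(1)[OF that] that] inv that by simp
    show "inj_on (\<lambda>z. g (inv_into A f z)) (f ` A)"
      using g assms by (auto simp: inj_on_def)
    show "(\<lambda>z. g (inv_into A f z)) ` f ` A = g ` A" using g by (force simp: image_iff)
  qed
qed

lemma (in group) card_rcosets_eq_card_image:
  assumes H: "subgroup H G"
    and f: "\<And>x y. x \<in> carrier G \<Longrightarrow> y \<in> carrier G \<Longrightarrow> f x = f y \<longleftrightarrow> x \<otimes> inv y \<in> H"
  shows "card (rcosets H) = card (f ` carrier G)"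
proof -
  interpret H: subgroup H G by (rule H)
  have "H #> x = H #> y \<longleftrightarrow> f x = f y" if "x \<in> carrier G" "y \<in> carrier G" for x y
  proof -
    have "H #> x = H #> y \<longleftrightarrow> x \<in> H #> y"
      using repr_independence[of x H y] rcos_self[of x H] that H by blast
    also have "\<dots> \<longleftrightarrow> x \<otimes> inv y \<in> H"
      using H.rcos_module[OF is_group that(2,1)] by simp
    finally show ?thesis using f that by simp
  qed
  then have "card ((\<lambda>x. H #> x) ` carrier G) = card (f ` carrier G)" by (rule card_image_cong_fibres)
  moreover have "rcosets H = (\<lambda>x. H #> x) ` carrier G" by (auto simp: RCOSETS_def)
  ultimately show ?thesis by simp
qed

lemma integer_lattice_eq: "integer_lattice n = map_vec real_of_int ` carrier_vec n"
proof (rule subset_antisym; rule subsetI)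
  fix v :: "real vec" assume v: "v \<in> integer_lattice n"
  then have "v = map_vec real_of_int (map_vec floor v)"
    by (intro eq_vecI) (auto simp: integer_lattice_def)
  moreover have "map_vec floor v \<in> carrier_vec n" using v by (simp add: integer_lattice_def)
  ultimately show "v \<in> map_vec real_of_int ` carrier_vec n" by blast
qed (auto simp: integer_lattice_def)

text \<open>
  The identity matrix makes the whole integer lattice a coincidence lattice, hence a subgroup.
\<close>

lemma group_integer_lattice_group: "group (integer_lattice_group n)"
  and subgroup_coincidence_lattice:
    "Y \<in> carrier_mat n n \<Longrightarrow> subgroup (coincidence_lattice n Y) (integer_lattice_group n)"
proof -
  interpret V: comm_group "monoid_vec TYPE(real) n" by (rule comm_group_vec)
  have "coincidence_lattice n (1\<^sub>m n) = integer_lattice n"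
    unfolding coincidence_lattice_def integer_lattice_def by force
  then have L: "subgroup (integer_lattice n) (monoid_vec TYPE(real) n)"
    using coincidence_lattice_subgroup[of "1\<^sub>m n" n] by simp
  then show "group (integer_lattice_group n)"
    unfolding integer_lattice_group_def by (rule V.subgroup_imp_group)
  show "subgroup (coincidence_lattice n Y) (integer_lattice_group n)" if "Y \<in> carrier_mat n n"
    unfolding integer_lattice_group_def
    by (rule V.subgroup_incl[OF coincidence_lattice_subgroup[OF that] L]) (auto simp: coincidence_lattice_def)
qed

lemma inv_integer_lattice_group:
  assumes "v \<in> integer_lattice n"
  shows "inv\<^bsub>integer_lattice_group n\<^esub> v = - v"
proof -
  interpret group "integer_lattice_group n" by (rule group_integer_lattice_group)
  show ?thesis using assms
    by (intro inv_equality) (auto simp: integer_lattice_group_def monoid_vec_simps integer_lattice_def)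
qed

text \<open>
  \<open>v\<close> lies in \<open>Y\<close> times the integer lattice iff \<open>Y\<^sup>T v\<close> is integral, as \<open>Y\<^sup>T\<close> is the
  inverse of \<open>Y\<close>.
\<close>

lemma of_int_mem_coincidence_lattice_iff:
  assumes Y: "Y \<in> rational_orthogonal_group n" and q: "q > 0" and Z: "Z \<in> carrier_mat n n"
    and YZ: "Y = (1 / real q) \<cdot>\<^sub>m map_mat real_of_int Z" and w: "w \<in> carrier_vec n"
  shows "map_vec real_of_int w \<in> coincidence_lattice n Y \<longleftrightarrow>
    (\<forall>i<n. int q dvd (transpose_mat Z *\<^sub>v w) $ i)"
proof -
  let ?v = "map_vec real_of_int w"
  have Yc: "Y \<in> carrier_mat n n" "transpose_mat Y * Y = 1\<^sub>m n" "Y * transpose_mat Y = 1\<^sub>m n"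
    using Y by (auto simp: rational_orthogonal_group_def)
  have v: "?v \<in> carrier_vec n" "?v \<in> integer_lattice n" using w by (auto simp: integer_lattice_def)
  have "?v \<in> coincidence_lattice n Y \<longleftrightarrow> transpose_mat Y *\<^sub>v ?v \<in> integer_lattice n"
  proof
    assume "?v \<in> coincidence_lattice n Y"
    then obtain u where u: "u \<in> integer_lattice n" "?v = Y *\<^sub>v u" by (auto simp: coincidence_lattice_def)
    then have "u \<in> carrier_vec n" by (simp add: integer_lattice_def)
    then have "transpose_mat Y *\<^sub>v ?v = u"
      unfolding u(2) using Yc assoc_mult_mat_vec[of "transpose_mat Y" n n Y n u] by simp
    then show "transpose_mat Y *\<^sub>v ?v \<in> integer_lattice n" using u by simp
  next
    assume a: "transpose_mat Y *\<^sub>v ?v \<in> integer_lattice n"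
    have "Y *\<^sub>v (transpose_mat Y *\<^sub>v ?v) = ?v"
      using Yc v assoc_mult_mat_vec[of Y n n "transpose_mat Y" n ?v] by simp
    then show "?v \<in> coincidence_lattice n Y"
      using a v unfolding coincidence_lattice_def by (metis IntI imageI)
  qed
  also have "\<dots> \<longleftrightarrow> (\<forall>i<n. (transpose_mat Y *\<^sub>v ?v) $ i \<in> \<int>)"
    using Yc v by (simp add: integer_lattice_def)
  also have "\<dots> \<longleftrightarrow> (\<forall>i<n. int q dvd (transpose_mat Z *\<^sub>v w) $ i)"
  proof -
    have "(transpose_mat Y *\<^sub>v ?v) $ i = real_of_int ((transpose_mat Z *\<^sub>v w) $ i) / real q" if "i < n" for i
      using that Z w by (simp add: YZ scalar_prod_def sum_divide_distrib)
    moreover have "real_of_int x / real q \<in> \<int> \<longleftrightarrow> int q dvd x" for x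
    proof
      assume "real_of_int x / real q \<in> \<int>"
      then obtain k where "real_of_int x / real q = real_of_int k" by (elim Ints_cases)
      then have "real_of_int x = real_of_int (int q * k)" using q by (simp add: field_simps)
      then have "x = int q * k" by (simp only: of_int_eq_iff)
      then show "int q dvd x" by simp
    qed (use q in auto)
    ultimately show ?thesis by simp
  qed
  finally show ?thesis .
qed

text \<open>
  The vector of residues of \<open>Q\<inverse> w\<close> modulo the numbers \<open>q div gcd q (d i)\<close> separates exactly the
  cosets of the coincidence lattice, so the index is the number of such vectors.
\<close>

lemma coincidence_index_eq_prod:
  assumes Y: "Y \<in> rational_orthogonal_group n" and q: "q > 0" and Z: "Z \<in> carrier_mat n n"
    and YZ: "Y = (1 / real q) \<cdot>\<^sub>m map_mat real_of_int Z"
    and eq: "mat_equiv n (transpose_mat Z) (mat_diag n d)"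
  shows "int (coincidence_index n Y) = (\<Prod>i<n. int q div gcd (int q) (d i))"
proof -
  obtain P Q where PQ: "P \<in> unimodular n" "Q \<in> unimodular n" and D: "mat_diag n d = P * transpose_mat Z * Q"
    using eq unfolding mat_equiv_def by blast
  obtain Q' where Q': "Q' \<in> unimodular n" "Q' \<in> carrier_mat n n" "Q * Q' = 1\<^sub>m n"
    using PQ(2) by (rule unimodularE)
  define e where "e i = int q div gcd (int q) (d i)" for i
  have e: "0 < e i" for i using q by (simp add: e_def pos_imp_zdiv_pos_iff zdvd_imp_le)
  let ?G = "integer_lattice_group n"
  let ?H = "coincidence_lattice n Y"
  define f where "f v = residue_vec Q' n e (map_vec floor v)" for v :: "real vec"
  have Yc: "Y \<in> carrier_mat n n" using Y by (simp add: rational_orthogonal_group_def)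
  have carrier: "carrier ?G = map_vec real_of_int ` carrier_vec n"
    by (simp add: integer_lattice_group_def integer_lattice_eq)
  have floor: "map_vec floor (map_vec real_of_int w) = w" for w by (intro eq_vecI) auto
  have f: "f (map_vec real_of_int w) = residue_vec Q' n e w" for w by (simp add: f_def floor)
  interpret G: group ?G by (rule group_integer_lattice_group)
  have "card (rcosets\<^bsub>?G\<^esub> ?H) = card (f ` carrier ?G)"
  proof (rule G.card_rcosets_eq_card_image[OF subgroup_coincidence_lattice[OF Yc]])
    fix x y assume "x \<in> carrier ?G" "y \<in> carrier ?G"
    then obtain u w where u: "u \<in> carrier_vec n" "x = map_vec real_of_int u"
      and w: "w \<in> carrier_vec n" "y = map_vec real_of_int w"
      unfolding carrier by auto
    have "f x = f y \<longleftrightarrow> (\<forall>i<n. e i dvd (Q' *\<^sub>v (u - w)) $ i)"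
      unfolding u w f using residue_vec_eq_iff[OF Q'(2) u(1) w(1)] .
    also have "\<dots> \<longleftrightarrow> (\<forall>i<n. int q dvd (transpose_mat Z *\<^sub>v (u - w)) $ i)"
      unfolding e_def using diagonalised_dvd_iff[OF _ PQ Q'(2,3) D, of "u - w" "int q"] Z u w q by simp
    also have "\<dots> \<longleftrightarrow> map_vec real_of_int (u - w) \<in> ?H"
      using of_int_mem_coincidence_lattice_iff[OF Y q Z YZ] u w by simp
    also have "map_vec real_of_int (u - w) = x \<otimes>\<^bsub>?G\<^esub> inv\<^bsub>?G\<^esub> y"
    proof -
      have "y \<in> integer_lattice n" using w by (simp add: integer_lattice_eq)
      then have "inv\<^bsub>?G\<^esub> y = - y" by (rule inv_integer_lattice_group)
      then show ?thesis using u w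
        by (auto simp: integer_lattice_group_def monoid_vec_simps intro!: eq_vecI)
    qed
    finally show "f x = f y \<longleftrightarrow> x \<otimes>\<^bsub>?G\<^esub> inv\<^bsub>?G\<^esub> y \<in> ?H" .
  qed
  also have "f ` carrier ?G = residue_vec Q' n e ` carrier_vec n"
    unfolding carrier image_image f ..
  also have "\<dots> = (\<Pi>\<^sub>E i\<in>{..<n}. {0..<e i})" using image_residue_vec[OF Q'(1), of e] e by simp
  also have "card \<dots> = (\<Prod>i<n. nat (e i))" by (simp add: card_PiE)
  finally have "int (coincidence_index n Y) = (\<Prod>i<n. int (nat (e i)))" by (simp add: coincidence_index_def)
  also have "\<dots> = (\<Prod>i<n. e i)" using e by (intro prod.cong) (auto simp: less_imp_le)
  finally show ?thesis by (simp add: e_def)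
qed

section \<open>The index formula\<close>

lemma dvd_of_complementary_dvd:
  fixes a b q :: int
  assumes "a dvd b" "\<bar>a\<bar> * \<bar>b\<bar> = q\<^sup>2" "q \<noteq> 0"
  shows "a dvd q" "q dvd b"
proof -
  have a: "a \<noteq> 0" using assms by auto
  have "a\<^sup>2 dvd a * b" using assms(1) by (simp add: power2_eq_square)
  also have "a * b dvd q\<^sup>2" using assms(2) by (metis abs_dvd_iff abs_mult dvd_refl)
  finally show "a dvd q" by simp
  then obtain k where k: "q = a * k" by (elim dvdE)
  have "\<bar>a\<bar> * \<bar>b\<bar> = \<bar>q * q\<bar>" using assms(2) by (simp add: power2_eq_square)
  also have "q * q = a * (k * q)" using k by (metis mult.assoc)
  finally have "\<bar>b\<bar> = \<bar>k * q\<bar>" using a by (simp add: abs_mult mult.assoc)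
  then show "q dvd b" by (metis abs_dvd_iff dvd_abs_iff dvd_triv_right)
qed

theorem theorem3p1:
  fixes n q :: nat and Y :: "real mat" and Z :: "int mat"
  assumes "n \<ge> 1"
    and "Y \<in> rational_orthogonal_group n"
    and "q > 0"
    and "Z \<in> carrier_mat n n"
    and "mat_gcd Z = 1"
    and "Y = (1 / real q) \<cdot>\<^sub>m map_mat real_of_int Z"
  shows "real (coincidence_index n Y) = real q ^ (n div 2) / real_of_int (det_divisor Z (n div 2))"
proof -
  note Y = assms(2) and q = assms(3) and Z = assms(4) and YZ = assms(6)
  let ?M = "transpose_mat Z"
  have M: "?M \<in> carrier_mat n n" using Z by simp
  have MM: "?M * transpose_mat ?M = (int q)\<^sup>2 \<cdot>\<^sub>m 1\<^sub>m n"
  proof (rule eq_matI)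
    fix i j assume "i < dim_row ((int q)\<^sup>2 \<cdot>\<^sub>m 1\<^sub>m n)" "j < dim_col ((int q)\<^sup>2 \<cdot>\<^sub>m 1\<^sub>m n)"
    then have ij: "i < n" "j < n" by auto
    have "(transpose_mat Y * Y) $$ (i, j) = real_of_int ((?M * transpose_mat ?M) $$ (i, j)) / (real q)\<^sup>2"
      using ij Z by (simp add: YZ scalar_prod_def sum_divide_distrib power2_eq_square)
    moreover have "(transpose_mat Y * Y) $$ (i, j) = (if i = j then 1 else 0)"
      using Y ij by (simp add: rational_orthogonal_group_def)
    ultimately have "real_of_int ((?M * transpose_mat ?M) $$ (i, j)) = (if i = j then (real q)\<^sup>2 else 0)"
      using q by (simp add: field_simps split: if_splits)
    also have "\<dots> = real_of_int (if i = j then (int q)\<^sup>2 else 0)" by simp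
    finally have "real_of_int ((?M * transpose_mat ?M) $$ (i, j)) = real_of_int (if i = j then (int q)\<^sup>2 else 0)" .
    then have "(?M * transpose_mat ?M) $$ (i, j) = (if i = j then (int q)\<^sup>2 else 0)"
      by (simp only: of_int_eq_iff)
    then show "(?M * transpose_mat ?M) $$ (i, j) = ((int q)\<^sup>2 \<cdot>\<^sub>m 1\<^sub>m n) $$ (i, j)" using ij by simp
  qed (use Z in auto)
  obtain d where eq: "mat_equiv n ?M (mat_diag n d)" and d: "\<And>i j. i \<le> j \<Longrightarrow> j < n \<Longrightarrow> d i dvd d j"
    using smith_normal_form_exists[OF M] by blast
  have dd: "\<bar>d i\<bar> * \<bar>d (n - 1 - i)\<bar> = (int q)\<^sup>2" if "i < n" for i
    using abs_mult_reversed_diagonal[OF M MM _ eq d that] q by simp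
  define m where "m = n div 2"
  have low: "d i dvd int q" if "i < m" for i
  proof (rule dvd_of_complementary_dvd(1))
    show "d i dvd d (n - 1 - i)" using that by (intro d) (auto simp: m_def)
    show "\<bar>d i\<bar> * \<bar>d (n - 1 - i)\<bar> = (int q)\<^sup>2" using that by (intro dd) (auto simp: m_def)
  qed (use q in simp)
  \<comment> \<open>For odd \<open>n\<close> the middle index \<open>i = m\<close> is its own mirror image; it belongs to this half.\<close>
  have high: "int q dvd d i" if "m \<le> i" "i < n" for i
  proof (rule dvd_of_complementary_dvd(2))
    show "d (n - 1 - i) dvd d i" using that by (intro d) (auto simp: m_def)
    show "\<bar>d (n - 1 - i)\<bar> * \<bar>d i\<bar> = (int q)\<^sup>2" using dd[OF that(2)] by (simp add: mult.commute)
  qed (use q in simp)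
  have "int (coincidence_index n Y) = (\<Prod>i<n. int q div gcd (int q) (d i))"
    by (rule coincidence_index_eq_prod[OF Y q Z YZ eq])
  also have "\<dots> = (\<Prod>i<m. int q div gcd (int q) (d i))"
  proof (rule prod.mono_neutral_right)
    show "\<forall>i\<in>{..<n} - {..<m}. int q div gcd (int q) (d i) = 1"
      using high q by (auto simp: gcd_proj1_if_dvd_int)
  qed (auto simp: m_def)
  also have "\<dots> = (\<Prod>i<m. int q div \<bar>d i\<bar>)"
    using low by (intro prod.cong) (auto simp: gcd_proj2_if_dvd_int)
  finally have "real (coincidence_index n Y) = (\<Prod>i<m. real_of_int (int q div \<bar>d i\<bar>))"
    by (metis of_int_of_nat_eq of_int_prod)
  also have "\<dots> = (\<Prod>i<m. real q / real_of_int \<bar>d i\<bar>)"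
    using low by (intro prod.cong) (auto simp: real_of_int_div)
  also have "\<dots> = real q ^ m / real_of_int \<bar>\<Prod>i<m. d i\<bar>"
    by (simp add: prod_dividef abs_prod)
  also have "\<bar>\<Prod>i<m. d i\<bar> = det_divisor Z m"
    using det_divisor_divisor_chain[of n d m] d det_divisor_mat_equiv[OF M eq, of m]
    by (simp add: m_def det_divisor_transpose)
  finally show ?thesis by (simp add: m_def)
qed

end
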